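(* Let $X$ be a real normed space and $K\subset X$ a closed convex pointed cone which is solid, i.e. $\operatorname{int}K\neq\emptyset$. Let $A,B,C\subset X$ be nonempty sets such that $C$ is weakly $K$-compact and $$A+C\subset C+B+\operatorname{int}K.$$ Then $$A\subset \operatorname{conv}B+\operatorname{int}K.$$
   Context: Sums of sets are Minkowski sums; $\operatorname{int}$ is the norm-topological interior and $\operatorname{conv}$ the convex hull. A cone $K$ is pointed if $K\cap(-K)=\{0\}$. A nonempty set $C\subset X$ is called weakly $K$-compact if from every cover of $C$ by sets of the form $U+K$, with $U\subset X$ weakly open, one can extract a finite subcover. *)

theory Defs
  imports "HOL-Analysis.Analysis"
begin

(* The weak topology: the coarsest topology for which every norm-continuous
   linear functional is continuous. *)
definition weak_topology :: "'a::real_normed_vector topology" where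
  "weak_topology =
     topology_generated_by {f -` V | (f :: 'a \<Rightarrow> real) V. bounded_linear f \<and> open V}"

lemma topspace_weak_topology [simp]:
  "topspace (weak_topology :: 'a::real_normed_vector topology) = UNIV"
proof -
  have "UNIV \<in> {f -` V | (f :: 'a \<Rightarrow> real) V. bounded_linear f \<and> open V}"
  proof (intro CollectI exI conjI)
    show "UNIV = (\<lambda>x :: 'a. 0 :: real) -` UNIV"
      by simp
  qed (rule bounded_linear_zero, rule open_UNIV)
  then show ?thesis
    unfolding weak_topology_def topology_generated_by_topspace
    by (intro top.extremum_uniqueI Union_upper)
qed

lemma continuous_map_weak_topology:
  fixes f :: "'a::real_normed_vector \<Rightarrow> real"
  assumes "bounded_linear f"
  shows "continuous_map weak_topology euclidean f"
proof -
  have "openin weak_topology (f -` V)" if "open V" for V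
    unfolding weak_topology_def
    by (rule topology_generated_by_Basis, rule CollectI, rule exI[of _ f], rule exI[of _ V])
      (simp add: assms that)
  then show ?thesis
    by (simp add: continuous_map_def vimage_def)
qed

(* The operation + on sets is the Minkowski sum. *)
definition weakly_K_compact :: "'a::real_normed_vector set \<Rightarrow> 'a set \<Rightarrow> bool" where
  "weakly_K_compact K C \<longleftrightarrow>
     C \<noteq> {} \<and>
     (\<forall>\<V>. (\<forall>V\<in>\<V>. \<exists>U. openin weak_topology U \<and> V = U + K) \<and> C \<subseteq> \<Union>\<V>
        \<longrightarrow> (\<exists>\<W>\<subseteq>\<V>. finite \<W> \<and> C \<subseteq> \<Union>\<W>))"

end

(* If some a in A were outside the open convex set conv B + int K, Hahn-Banach would give a bounded
   linear functional f with f a < f b + f k for all b in conv B and k in int K; in particular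
   f is nonnegative on K.  Hence the sets {f > f c} absorb K, and weak K-compactness makes f attain
   its minimum over C, at c0 say.  Writing a + c0 = c + b + k gives f c < f c0, a contradiction.

   The separating functional comes from Zorn's lemma: a maximal blunt convex cone M containing
   an open set is a total linear order, whose comparison with the line through an interior point u
   yields f (f x is the cut at which x - t u changes from positive to negative). *)
theory Submission
  imports Defs
begin

section \<open>Maximal blunt convex cones\<close>

text \<open>Such an \<open>M\<close> is the positive part of a strict vector order, with x below y
  iff \<open>y - x \<in> M\<close>; leaving out 0 gives irreflexivity.\<close>

definition blunt_convex_cone :: "'a::real_vector set \<Rightarrow> bool" where
  "blunt_convex_cone M \<longleftrightarrow>
     0 \<notin> M \<and> (\<forall>x\<in>M. \<forall>y\<in>M. x + y \<in> M) \<and> (\<forall>x\<in>M. \<forall>t>0. t *\<^sub>R x \<in> M)"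

lemma blunt_convex_coneD:
  assumes "blunt_convex_cone M"
  shows "0 \<notin> M"
    and "x \<in> M \<Longrightarrow> y \<in> M \<Longrightarrow> x + y \<in> M"
    and "x \<in> M \<Longrightarrow> t > 0 \<Longrightarrow> t *\<^sub>R x \<in> M"
  using assms by (auto simp: blunt_convex_cone_def)

lemma blunt_convex_cone_generated:
  assumes "convex S" "0 \<notin> S"
  shows "blunt_convex_cone {t *\<^sub>R s |t s. t > 0 \<and> s \<in> S}"
  unfolding blunt_convex_cone_def
proof (intro conjI ballI allI impI)
  show "0 \<notin> {t *\<^sub>R s |t s. t > 0 \<and> s \<in> S}"
    using assms(2) by auto
next
  fix x y assume "x \<in> {t *\<^sub>R s |t s. t > 0 \<and> s \<in> S}" "y \<in> {t *\<^sub>R s |t s. t > 0 \<and> s \<in> S}"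
  then obtain t s t' s' where *: "x = t *\<^sub>R s" "t > 0" "s \<in> S" "y = t' *\<^sub>R s'" "t' > 0" "s' \<in> S"
    by blast
  \<comment> \<open>The weighted mean of \<open>s\<close> and \<open>s'\<close> whose multiple by
    \<open>t + t'\<close> is \<open>x + y\<close>.\<close>
  define z where "z = (t / (t + t')) *\<^sub>R s + (t' / (t + t')) *\<^sub>R s'"
  have "z \<in> S"
    unfolding z_def using * by (intro convexD[OF assms(1)]) (auto simp flip: add_divide_distrib)
  moreover have "x + y = (t + t') *\<^sub>R z"
    using * by (simp add: z_def scaleR_add_right)
  ultimately show "x + y \<in> {t *\<^sub>R s |t s. t > 0 \<and> s \<in> S}"
    using * by (intro CollectI exI[of _ "t + t'"] exI[of _ z]) auto
next
  fix x and c :: real assume "x \<in> {t *\<^sub>R s |t s. t > 0 \<and> s \<in> S}" "c > 0"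
  then obtain t s where "x = t *\<^sub>R s" "t > 0" "s \<in> S" by blast
  with \<open>c > 0\<close> show "c *\<^sub>R x \<in> {t *\<^sub>R s |t s. t > 0 \<and> s \<in> S}"
    by (intro CollectI exI[of _ "c * t"] exI[of _ s]) auto
qed

text \<open>Zorn's lemma applies because any two points in the union of a chain already lie in a
  common member.\<close>

lemma blunt_convex_cone_maximal:
  assumes "blunt_convex_cone P"
  obtains M where "blunt_convex_cone M" "P \<subseteq> M"
    "\<And>N. blunt_convex_cone N \<Longrightarrow> M \<subseteq> N \<Longrightarrow> N = M"
proof -
  let ?F = "{M. blunt_convex_cone M \<and> P \<subseteq> M}"
  have "\<exists>M\<in>?F. \<forall>X\<in>?F. M \<subseteq> X \<longrightarrow> X = M"
  proof (rule subset_Zorn_nonempty)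
    show "?F \<noteq> {}" using assms by blast
  next
    fix Ch assume "Ch \<noteq> {}" and ch: "subset.chain ?F Ch"
    have Ch: "blunt_convex_cone N" "P \<subseteq> N" if "N \<in> Ch" for N
      using ch that by (auto simp: subset_chain_def)
    have "x + y \<in> \<Union>Ch" if "x \<in> \<Union>Ch" "y \<in> \<Union>Ch" for x y
    proof -
      from that obtain N N' where "x \<in> N" "N \<in> Ch" "y \<in> N'" "N' \<in> Ch" by blast
      moreover from this ch have "N \<subseteq> N' \<or> N' \<subseteq> N" by (simp add: subset_chain_def)
      ultimately obtain L where "L \<in> Ch" "x \<in> L" "y \<in> L" by blast
      then show ?thesis using Ch blunt_convex_coneD(2) by blast
    qed
    moreover have "0 \<notin> \<Union>Ch" "\<And>x t. x \<in> \<Union>Ch \<Longrightarrow> t > 0 \<Longrightarrow> t *\<^sub>R x \<in> \<Union>Ch"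
      using Ch(1) blunt_convex_coneD(1,3) by blast+
    moreover have "P \<subseteq> \<Union>Ch" using \<open>Ch \<noteq> {}\<close> Ch(2) by blast
    ultimately show "\<Union>Ch \<in> ?F" by (auto simp: blunt_convex_cone_def)
  qed
  then obtain M where M: "M \<in> ?F" "\<forall>X\<in>?F. M \<subseteq> X \<longrightarrow> X = M" ..
  show thesis
  proof
    show "blunt_convex_cone M" "P \<subseteq> M" using M(1) by auto
    show "N = M" if "blunt_convex_cone N" "M \<subseteq> N" for N
      using M(2) \<open>P \<subseteq> M\<close> that by auto
  qed
qed

text \<open>Adjoin the ray of \<open>x\<close> to \<open>M\<close>. Either the enlarged cone still
  omits 0, and maximality forces \<open>x \<in> M\<close>, or a relation \<open>0 = m + t x\<close>
  exhibits \<open>- x\<close> as a positive multiple of an element of \<open>M\<close>.\<close>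

lemma maximal_blunt_convex_cone_total:
  assumes M: "blunt_convex_cone M" and max: "\<And>N. blunt_convex_cone N \<Longrightarrow> M \<subseteq> N \<Longrightarrow> N = M"
    and "x \<noteq> 0"
  shows "x \<in> M \<or> - x \<in> M"
proof -
  \<comment> \<open>Admitting \<open>m = 0\<close> or \<open>t = 0\<close> makes \<open>N\<close>
    contain both \<open>x\<close> and \<open>M\<close>; the last condition excludes only the trivial
    representation of 0.\<close>
  define N where "N = {m + t *\<^sub>R x |m t. m \<in> insert 0 M \<and> t \<ge> 0 \<and> (m \<noteq> 0 \<or> t \<noteq> 0)}"
  have NI: "m + t *\<^sub>R x \<in> N" if "m \<in> insert 0 M" "t \<ge> 0" "m \<noteq> 0 \<or> t \<noteq> 0" for m t
    using that unfolding N_def by blast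
  have sub: "M \<subseteq> N"
    using NI[of _ 0] blunt_convex_coneD(1)[OF M] by fastforce
  have x: "x \<in> N" using NI[of 0 1] by simp
  show ?thesis
  proof (cases "0 \<in> N")
    case False
    have "y + z \<in> N" if yz: "y \<in> N" "z \<in> N" for y z
    proof -
      obtain m t m' t' where *: "y = m + t *\<^sub>R x" "m \<in> insert 0 M" "t \<ge> 0" "m \<noteq> 0 \<or> t \<noteq> 0"
        "z = m' + t' *\<^sub>R x" "m' \<in> insert 0 M" "t' \<ge> 0" "m' \<noteq> 0 \<or> t' \<noteq> 0"
        using yz unfolding N_def by blast
      have "m + m' \<in> insert 0 M"
        using *(2,6) blunt_convex_coneD(2)[OF M] by auto
      \<comment> \<open>If both summands are in \<open>M\<close>, so is their sum, which is then
        nonzero; otherwise one of them is 0 and its coefficient is positive.\<close>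
      moreover have "m + m' \<noteq> 0 \<or> t + t' \<noteq> 0"
      proof (cases "m \<in> M \<and> m' \<in> M")
        case True
        then show ?thesis using blunt_convex_coneD(1,2)[OF M] by metis
      next
        case False
        then show ?thesis using *(2,3,4,6,7,8) by auto
      qed
      moreover have "y + z = (m + m') + (t + t') *\<^sub>R x"
        using * by (simp add: algebra_simps)
      ultimately show ?thesis using NI[of "m + m'" "t + t'"] *(3,7) by simp
    qed
    moreover have "c *\<^sub>R y \<in> N" if y: "y \<in> N" and "c > 0" for y c
    proof -
      obtain m t where *: "y = m + t *\<^sub>R x" "m \<in> insert 0 M" "t \<ge> 0" "m \<noteq> 0 \<or> t \<noteq> 0"
        using y unfolding N_def by blast
      then have "c *\<^sub>R y = c *\<^sub>R m + (c * t) *\<^sub>R x" by (simp add: algebra_simps)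
      then show ?thesis
        using NI[of "c *\<^sub>R m" "c * t"] * \<open>c > 0\<close> blunt_convex_coneD(3)[OF M] by auto
    qed
    ultimately have "blunt_convex_cone N" using False by (simp add: blunt_convex_cone_def)
    then show ?thesis using max sub x by blast
  next
    case True
    then obtain m t where *: "0 = m + t *\<^sub>R x" "m \<in> insert 0 M" "t \<ge> 0" "m \<noteq> 0 \<or> t \<noteq> 0"
      unfolding N_def by blast
    have "m \<noteq> 0" "t \<noteq> 0" using * \<open>x \<noteq> 0\<close> by auto
    then have "m \<in> M" "t > 0" using * by auto
    moreover have "- x = (1 / t) *\<^sub>R m"
    proof -
      have "m = - (t *\<^sub>R x)" using *(1) by (simp add: eq_neg_iff_add_eq_0)
      then show ?thesis using \<open>t \<noteq> 0\<close> by simp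
    qed
    ultimately show ?thesis using blunt_convex_coneD(3)[OF M, of m "1 / t"] by simp
  qed
qed

section \<open>From a total cone to a bounded functional\<close>

text \<open>\<open>f x\<close> is the Dedekind cut of \<open>x\<close> against the line of multiples
  of \<open>u\<close>. The ball makes \<open>u\<close> an order unit, so the cut is finite; totality
  gives its existence, antisymmetry (\<open>opp\<close>) its uniqueness.\<close>

lemma total_blunt_convex_cone_functional:
  fixes M :: "'a::real_normed_vector set"
  assumes M: "blunt_convex_cone M" and total: "\<And>x. x \<noteq> 0 \<Longrightarrow> x \<in> M \<or> - x \<in> M"
    and "e > 0" and ball: "ball u e \<subseteq> M"
  obtains f :: "'a \<Rightarrow> real" where "bounded_linear f" "f u = 1" "\<And>x. x \<in> M \<Longrightarrow> f x \<ge> 0"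
proof -
  note add = blunt_convex_coneD(2)[OF M] and scale = blunt_convex_coneD(3)[OF M]
  have opp: False if "x \<in> M" "- x \<in> M" for x
    using add[OF that] blunt_convex_coneD(1)[OF M] by simp
  have u: "u \<in> M" using ball \<open>e > 0\<close> by auto
  \<comment> \<open>The vector is \<open>t\<close> times \<open>u - x / t\<close>, a point of the
    ball. This estimate bounds the cuts and later yields the norm bound on \<open>f\<close>.\<close>
  have big: "t *\<^sub>R u - x \<in> M" if "t > norm x / e" for x t
  proof -
    have "t > 0" using that \<open>e > 0\<close> by (meson divide_nonneg_pos norm_ge_zero order_le_less_trans)
    then have "dist u (u - x /\<^sub>R t) < e"
      using that \<open>e > 0\<close> by (simp add: dist_norm field_simps)
    then have "u - x /\<^sub>R t \<in> M" using ball by (simp only: mem_ball subset_eq)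
    then have "t *\<^sub>R (u - x /\<^sub>R t) \<in> M" using scale \<open>t > 0\<close> by blast
    then show ?thesis using \<open>t > 0\<close> by (simp add: algebra_simps)
  qed
  \<comment> \<open>Nothing is asked at \<open>t = r\<close>: the order may have infinitesimals, so
    \<open>x - r u\<close> can be zero or of either sign.\<close>
  define cut where "cut x r \<longleftrightarrow> (\<forall>t<r. x - t *\<^sub>R u \<in> M) \<and> (\<forall>t>r. t *\<^sub>R u - x \<in> M)" for x r
  have cut_le: "r \<le> r'" if "cut x r" "cut x r'" for x r r'
  proof (rule ccontr)
    assume "\<not> r \<le> r'"
    then obtain t where "r' < t" "t < r" using dense by (metis not_le)
    then show False using that opp[of "x - t *\<^sub>R u"] by (simp add: cut_def)
  qed
  then have cut_unique: "r = r'" if "cut x r" "cut x r'" for x r r'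
    using that by (meson order_antisym)
  have cut_ex: "\<exists>r. cut x r" for x
  proof -
    define L where "L = {t. x - t *\<^sub>R u \<in> M}"
    have down: "s \<in> L" if "t \<in> L" "s < t" for s t
      using add[of "x - t *\<^sub>R u" "(t - s) *\<^sub>R u"] scale[OF u, of "t - s"] that
      by (simp add: L_def algebra_simps)
    have bdd: "bdd_above L"
    proof (rule bdd_aboveI)
      fix t assume "t \<in> L"
      then show "t \<le> norm x / e"
        using big[of x t] opp[of "x - t *\<^sub>R u"] by (auto simp: L_def not_le[symmetric])
    qed
    have "- (norm x / e + 1) \<in> L"
      using big[of "- x" "norm x / e + 1"] by (simp add: L_def algebra_simps)
    then have ne: "L \<noteq> {}" by blast
    have "cut x (Sup L)"
      unfolding cut_def
    proof (intro conjI allI impI)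
      fix t assume "t < Sup L"
      then obtain s where "s \<in> L" "t < s" using less_cSup_iff[OF ne bdd] by blast
      then show "x - t *\<^sub>R u \<in> M" using down by (auto simp: L_def)
    next
      fix t assume t: "Sup L < t"
      \<comment> \<open>Totality says nothing about the zero vector. The intermediate
        \<open>s\<close> rules out \<open>x = t u\<close>, which would put \<open>s\<close> in
        \<open>L\<close> above its supremum.\<close>
      then obtain s where s: "Sup L < s" "s < t" using dense by blast
      have "s \<notin> L" using s(1) cSup_upper[OF _ bdd] by force
      have "x \<noteq> t *\<^sub>R u"
        using scale[OF u, of "t - s"] s \<open>s \<notin> L\<close> by (auto simp: L_def scaleR_left_diff_distrib)
      moreover have "x - t *\<^sub>R u \<notin> M" using t cSup_upper[OF _ bdd, of t] by (auto simp: L_def)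
      ultimately show "t *\<^sub>R u - x \<in> M" using total[of "x - t *\<^sub>R u"] by simp
    qed
    then show ?thesis ..
  qed
  define f where "f x = (THE r. cut x r)" for x
  have f_eqI: "f x = r" if "cut x r" for x r
    unfolding f_def using that cut_unique by blast
  have cut_f: "cut x (f x)" for x using cut_ex f_eqI by metis
  have lo: "x - t *\<^sub>R u \<in> M" if "t < f x" for x t using cut_f that by (simp add: cut_def)
  have hi: "t *\<^sub>R u - x \<in> M" if "f x < t" for x t using cut_f that by (simp add: cut_def)
  have f_add: "f (x + y) = f x + f y" for x y
  proof (rule f_eqI, unfold cut_def, intro conjI allI impI)
    fix t assume "t < f x + f y"
    \<comment> \<open>Split \<open>t\<close> as \<open>s + (t - s)\<close>, with the two parts below
      the cuts of \<open>x\<close> and \<open>y\<close>.\<close>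
    then obtain s where "t - f y < s" "s < f x" using dense[of "t - f y" "f x"] by auto
    then show "x + y - t *\<^sub>R u \<in> M"
      using add[OF lo[of s x] lo[of "t - s" y]] by (simp add: algebra_simps)
  next
    fix t assume "f x + f y < t"
    then obtain s where "f x < s" "s < t - f y" using dense[of "f x" "t - f y"] by auto
    then show "t *\<^sub>R u - (x + y) \<in> M"
      using add[OF hi[of x s] hi[of y "t - s"]] by (simp add: algebra_simps)
  qed
  have f_scale_pos: "f (c *\<^sub>R x) = c * f x" if "c > 0" for c x
  proof (rule f_eqI, unfold cut_def, intro conjI allI impI)
    fix t assume "t < c * f x"
    then have "t / c < f x" using that by (simp add: field_simps)
    from scale[OF lo[OF this] that] show "c *\<^sub>R x - t *\<^sub>R u \<in> M"
      using that by (simp add: algebra_simps)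
  next
    fix t assume "c * f x < t"
    then have "f x < t / c" using that by (simp add: field_simps)
    from scale[OF hi[OF this] that] show "t *\<^sub>R u - c *\<^sub>R x \<in> M"
      using that by (simp add: algebra_simps)
  qed
  have f_0: "f 0 = 0" using f_add[of 0 0] by simp
  have f_minus: "f (- x) = - f x" for x using f_add[of x "- x"] f_0 by simp
  have f_scale: "f (c *\<^sub>R x) = c * f x" for c x
  proof (cases c "0 :: real" rule: linorder_cases)
    case less
    then show ?thesis using f_scale_pos[of "- c" x] f_minus[of "c *\<^sub>R x"] by simp
  qed (auto simp: f_0 f_scale_pos)
  have f_le: "f x \<le> norm x / e" for x
  proof (rule ccontr)
    assume "\<not> f x \<le> norm x / e"
    then obtain t where "norm x / e < t" "t < f x" using dense by (metis not_le)
    then show False using big[of x t] lo[of t x] opp[of "x - t *\<^sub>R u"] by simp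
  qed
  show thesis
  proof
    show "bounded_linear f"
    proof (rule bounded_linear_intro)
      show "norm (f x) \<le> norm x * (1 / e)" for x
        using f_le[of x] f_le[of "- x"] by (simp add: f_minus abs_le_iff)
    qed (simp_all add: f_add f_scale)
    show "f u = 1"
    proof (rule f_eqI, unfold cut_def, intro conjI allI impI)
      show "u - t *\<^sub>R u \<in> M" if "t < 1" for t
        using scale[OF u, of "1 - t"] that by (simp add: algebra_simps)
      show "t *\<^sub>R u - u \<in> M" if "1 < t" for t
        using scale[OF u, of "t - 1"] that by (simp add: algebra_simps)
    qed
    show "f x \<ge> 0" if "x \<in> M" for x
      \<comment> \<open>A negative value would put 0 above the cut and hence \<open>- x\<close> in
        \<open>M\<close>.\<close>
      using hi[of x 0] opp[OF that] by force
  qed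
qed

section \<open>Separation of the origin from an open convex set\<close>

text \<open>The maximal cone only gives \<open>f \<ge> 0\<close> on \<open>S\<close>. Openness makes
  this strict: a small step from \<open>s\<close> along \<open>- u\<close> stays in \<open>S\<close>
  and lowers \<open>f\<close>, since \<open>f u = 1\<close>.\<close>

theorem Hahn_Banach_open_convex:
  fixes S :: "'a::real_normed_vector set"
  assumes "open S" "convex S" "0 \<notin> S"
  obtains f :: "'a \<Rightarrow> real" where "bounded_linear f" "\<And>x. x \<in> S \<Longrightarrow> f x > 0"
proof (cases "S = {}")
  case True
  then show thesis using that[OF bounded_linear_zero] by blast
next
  case False
  then obtain u where "u \<in> S" by blast
  then obtain e where e: "e > 0" "ball u e \<subseteq> S" using \<open>open S\<close> open_contains_ball by blast
  obtain M where M: "blunt_convex_cone M" "{t *\<^sub>R s |t s. t > 0 \<and> s \<in> S} \<subseteq> M"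
    and max: "\<And>N. blunt_convex_cone N \<Longrightarrow> M \<subseteq> N \<Longrightarrow> N = M"
    using blunt_convex_cone_maximal[OF blunt_convex_cone_generated[OF assms(2,3)]] by blast
  have "S \<subseteq> M"
  proof
    fix s assume "s \<in> S"
    then have "1 *\<^sub>R s \<in> M" using M(2) zero_less_one by blast
    then show "s \<in> M" by simp
  qed
  with e(2) have "ball u e \<subseteq> M" by blast
  from total_blunt_convex_cone_functional[OF M(1)
      maximal_blunt_convex_cone_total[OF M(1) max] e(1) this]
  obtain f :: "'a \<Rightarrow> real" where f: "bounded_linear f" "f u = 1" "\<And>x. x \<in> M \<Longrightarrow> f x \<ge> 0"
    by blast
  show thesis
  proof (rule that[OF f(1)])
    interpret f: bounded_linear f by (fact f(1))
    fix s assume "s \<in> S"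
    then obtain d where d: "d > 0" "ball s d \<subseteq> S" using \<open>open S\<close> open_contains_ball by blast
    \<comment> \<open>Chosen so that \<open>r u\<close> has norm at most \<open>d / 2\<close>; the
      \<open>+ 1\<close> keeps the denominator positive.\<close>
    define r where "r = d / (2 * (norm u + 1))"
    have r: "r > 0" using d by (simp add: r_def add_nonneg_pos)
    have "norm (r *\<^sub>R u) < d"
    proof -
      have "norm u + 1 > 0" by (simp add: add_nonneg_pos)
      then have "r * norm u \<le> d / 2" using d(1) by (simp add: r_def field_simps)
      then show ?thesis using r d(1) by simp
    qed
    then have "s - r *\<^sub>R u \<in> S" using d(2) by (auto simp: dist_norm)
    then have "f (s - r *\<^sub>R u) \<ge> 0" using f(3) \<open>S \<subseteq> M\<close> by blast
    then show "f s > 0" using f(2) r by (simp add: f.diff f.scaleR)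
  qed
qed

section \<open>Minkowski sums and weak K-compactness\<close>

lemma open_set_plus:
  fixes S T :: "'a::real_normed_vector set"
  assumes "open S \<or> open T"
  shows "open (S + T)"
proof -
  have "S + T = (\<Union>x\<in>S. \<Union>y\<in>T. {x + y})" by (auto simp: set_plus_def)
  then show ?thesis using open_sums[OF assms] by simp
qed

text \<open>The translate of \<open>interior K\<close> by \<open>x\<close> is open and stays in
  \<open>K\<close>, because a convex cone is closed under addition.\<close>

lemma interior_convex_cone_plus:
  fixes K :: "'a::real_normed_vector set"
  assumes "convex K" "cone K" "k \<in> interior K" "x \<in> K"
  shows "k + x \<in> interior K"
proof (rule interiorI)
  show "open (interior K + {x})" by (simp add: open_set_plus)
  show "k + x \<in> interior K + {x}" using assms(3) by auto
  have "y + x \<in> K" if "y \<in> interior K" for y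
    using convex_cone[of K] assms(1,2,4) that interior_subset by blast
  then show "interior K + {x} \<subseteq> K" by (auto simp: set_plus_def)
qed

text \<open>Without a minimum, the strict upper level sets of \<open>f\<close> at points of
  \<open>C\<close> cover \<open>C\<close>. A finite subcover fails at the point with the least value
  among those defining it.\<close>

lemma weakly_K_compact_attains_min:
  fixes f :: "'a::real_normed_vector \<Rightarrow> real"
  assumes C: "weakly_K_compact K C" and f: "bounded_linear f"
    and "0 \<in> K" and pos: "\<And>k. k \<in> K \<Longrightarrow> f k \<ge> 0"
  obtains c where "c \<in> C" "\<And>c'. c' \<in> C \<Longrightarrow> f c \<le> f c'"
proof (rule ccontr)
  assume "\<not> thesis"
  with that have no_min: "\<exists>c'\<in>C. f c' < f c" if "c \<in> C" for c
    using \<open>c \<in> C\<close> by (meson not_le)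
  define U where "U c = {x. f c < f x}" for c
  have "openin weak_topology (U c)" for c
    using openin_continuous_map_preimage[OF continuous_map_weak_topology[OF f], of "{f c<..}"]
    by (simp add: U_def)
  \<comment> \<open>This gives the level sets the form required of covers: adding \<open>K\<close>
    cannot lower \<open>f\<close>, and \<open>0 \<in> K\<close> gives the other inclusion.\<close>
  moreover have "U c = U c + K" for c
  proof
    show "U c \<subseteq> U c + K" using \<open>0 \<in> K\<close> set_zero_plus2 by (metis add.commute)
    show "U c + K \<subseteq> U c"
      using pos by (fastforce simp: U_def set_plus_def linear_simps[OF f])
  qed
  ultimately have "\<forall>V\<in>U ` C. \<exists>W. openin weak_topology W \<and> V = W + K" by blast
  moreover have "C \<subseteq> \<Union>(U ` C)" using no_min by (auto simp: U_def)
  ultimately obtain \<W> where "\<W> \<subseteq> U ` C" "finite \<W>" and cov: "C \<subseteq> \<Union>\<W>"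
    using C unfolding weakly_K_compact_def by meson
  then obtain D where D: "D \<subseteq> C" "finite D" "\<W> = U ` D" by (meson finite_subset_image)
  have "D \<noteq> {}" using C cov D(3) by (auto simp: weakly_K_compact_def)
  then obtain d where d: "d \<in> D" "\<And>d'. d' \<in> D \<Longrightarrow> f d \<le> f d'"
    using arg_min_if_finite[OF D(2), of f] by (metis not_le)
  then obtain d' where "d' \<in> D" "d \<in> U d'" using cov D by blast
  then show False using d(2) by (force simp: U_def)
qed

section \<open>The cancellation theorem\<close>

theorem proposition2p6:
  fixes K A B C :: "'a::real_normed_vector set"
  assumes "closed K" and "convex K" and "cone K"
    and pointed: "K \<inter> uminus ` K = {0}"
    and solid: "interior K \<noteq> {}"
    and "A \<noteq> {}" and "B \<noteq> {}" and "C \<noteq> {}"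
    and "weakly_K_compact K C"
    and "A + C \<subseteq> C + B + interior K"
  shows "A \<subseteq> convex hull B + interior K"
proof
  fix a assume "a \<in> A"
  show "a \<in> convex hull B + interior K"
  proof (rule ccontr)
    assume a: "a \<notin> convex hull B + interior K"
    \<comment> \<open>Translating by \<open>- a\<close> turns separation from \<open>a\<close> into
      separation from 0.\<close>
    define S where "S = {- a} + (convex hull B + interior K)"
    have "open S" by (simp add: S_def open_set_plus)
    moreover have "convex S"
      using \<open>convex K\<close> by (simp add: S_def convex_set_plus)
    moreover have "0 \<notin> S" using a by (auto simp: S_def set_plus_def add.assoc[symmetric])
    ultimately obtain f :: "'a \<Rightarrow> real" where f: "bounded_linear f" and fS: "\<And>x. x \<in> S \<Longrightarrow> f x > 0"
      using Hahn_Banach_open_convex by blast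
    interpret f: bounded_linear f by (fact f)
    have sep: "f a < f b + f k" if "b \<in> convex hull B" "k \<in> interior K" for b k
    proof -
      have "- a + (b + k) \<in> S" unfolding S_def using that by (intro set_plus_intro) auto
      from fS[OF this] show ?thesis by (simp add: f.add f.diff)
    qed
    obtain b0 where "b0 \<in> B" using \<open>B \<noteq> {}\<close> by blast
    then have b0: "b0 \<in> convex hull B" by (simp add: hull_inc)
    obtain k0 where k0: "k0 \<in> interior K" using solid by blast
    have "f k \<ge> 0" if "k \<in> K" for k
    proof (rule ccontr)
      assume neg: "\<not> f k \<ge> 0"
      \<comment> \<open>The gap in \<open>sep\<close> at \<open>b0\<close> and \<open>k0\<close>. If
        \<open>f k < 0\<close>, adding the multiple of \<open>k\<close> on which \<open>f\<close>
        equals \<open>- s\<close> keeps \<open>k0\<close> in the interior but closes the gap, giving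
        \<open>f a < f a\<close>.\<close>
      define s where "s = f b0 + f k0 - f a"
      have "s > 0" using sep[OF b0 k0] by (simp add: s_def)
      then have "s / - f k \<ge> 0" using neg by (intro divide_nonneg_nonneg) auto
      then have "(s / - f k) *\<^sub>R k \<in> K" using mem_cone[OF \<open>cone K\<close> that] by blast
      from sep[OF b0 interior_convex_cone_plus[OF assms(2,3) k0 this]]
      have "f a < f b0 + (f k0 - s)" using neg by (simp add: f.add f.diff f.scaleR)
      then show False by (simp add: s_def)
    qed
    moreover have "0 \<in> K" using pointed by blast
    ultimately obtain c0 where c0: "c0 \<in> C" "\<And>c. c \<in> C \<Longrightarrow> f c0 \<le> f c"
      using weakly_K_compact_attains_min[OF assms(9) f] by blast
    have "a + c0 \<in> C + B + interior K" using assms(10) \<open>a \<in> A\<close> c0(1) by blast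
    then obtain c b k where *: "c \<in> C" "b \<in> B" "k \<in> interior K" "a + c0 = c + b + k"
      by (auto simp: set_plus_def)
    have "f a + f c0 = f c + f b + f k" using *(4) by (metis f.add)
    then show False using sep[of b k] * c0(2)[of c] by (simp add: hull_inc)
  qed
qed

end
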